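(* Let $\mathcal{W}=(w_n)_{n\ge 0}$ be a standard sequence of generating words with cutting parameters $(q_n)_{n \ge 0}$ and bounded spacer parameters $(a_{n,i})$ such that the minimal Ferenczi subshift $(X_{\mathcal{W}},S)$ is aperiodic. The system $(X_{\mathcal{W}}, S)$ has no continuous irrational eigenvalues. Moreover, for coprime integers $p,q$ with $q \ge 1$, the complex value $\lambda = \exp(2\pi i p/q)$ is a continuous eigenvalue of $(X_{\mathcal{W}}, S)$ if and only if there exists $n \ge 0$ such that $q$ divides $|w_n| + a_{m,i}$ for all $m \ge n$ and $0 \le i < q_m$.
   Context: $S$ is the shift; a subshift is aperiodic if it is nonempty and contains no shift-periodic point. Ferenczi subshifts. Given nonnegative integers $(q_n)_{n \ge 0}$ (cutting parameters) and $(a_{n,i} : n \ge 0, 0 \le i < q_n)$ (spacer parameters), the sequence of generating words $\mathcal{W} = (w_n)_{n \ge 0}$ over $\{0,1\}$ is $w_0 = 0$, $w_{n+1} = w_n 1^{a_{n,0}} w_n 1^{a_{n,1}} \cdots w_n 1^{a_{n,q_n-1}} w_n$. $X_{\mathcal{W}}$ is the set of $x \in \{0,1\}^{\mathbb{Z}}$ every finite factor of which is a factor of some $w_n$. $\mathcal{W}$ is standard if $q_n \ge 2$ for all $n$. If the spacers are bounded, $(X_{\mathcal{W}},S)$ is minimal. A complex number $\lambda$ is a continuous eigenvalue of $(X,T)$ if there is a continuous $f : X \to \mathbb{C}$, $f \ne 0$, with $f \circ T = \lambda f$. When $(X,T)$ is minimal such $\lambda$ has modulus $1$ and is written $\exp(2\pi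 i\alpha)$, $\alpha\in[0,1)$; it is called irrational if $\alpha$ is irrational. *)

theory Defs
  imports "HOL-Analysis.Analysis" "HOL-Library.Sublist"
begin

text \<open>
  Bi-infinite sequences over the alphabet \<open>{0, 1}\<close> have type \<open>int \<Rightarrow> nat\<close>. This type carries the
  product of the discrete topologies on \<open>nat\<close>, which induces on \<open>{0, 1}\<close>-valued sequences the usual
  product topology.
\<close>

definition shift :: "(int \<Rightarrow> 'a) \<Rightarrow> (int \<Rightarrow> 'a)" where
  "shift x = (\<lambda>k. x (k + 1))"

definition shift_periodic :: "(int \<Rightarrow> 'a) \<Rightarrow> bool" where
  "shift_periodic x \<longleftrightarrow> (\<exists>p::nat. p > 0 \<and> (shift ^^ p) x = x)"

definition aperiodic_subshift :: "(int \<Rightarrow> 'a) set \<Rightarrow> bool" where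
  "aperiodic_subshift X \<longleftrightarrow> X \<noteq> {} \<and> (\<forall>x\<in>X. \<not> shift_periodic x)"

definition is_factor :: "'a list \<Rightarrow> (int \<Rightarrow> 'a) \<Rightarrow> bool" where
  "is_factor u x \<longleftrightarrow> (\<exists>k. u = map (\<lambda>j. x (k + int j)) [0..<length u])"

text \<open>Only the values \<open>a n i\<close> with \<open>i < q n\<close> are spacer parameters; the other ones play no role.\<close>

primrec generating_word :: "(nat \<Rightarrow> nat) \<Rightarrow> (nat \<Rightarrow> nat \<Rightarrow> nat) \<Rightarrow> nat \<Rightarrow> nat list" where
  "generating_word q a 0 = [0]"
| "generating_word q a (Suc n) =
     concat (map (\<lambda>i. generating_word q a n @ replicate (a n i) 1) [0..<q n])
       @ generating_word q a n"

definition standard :: "(nat \<Rightarrow> nat) \<Rightarrow> bool" where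
  "standard q \<longleftrightarrow> (\<forall>n. q n \<ge> 2)"

definition bounded_spacers :: "(nat \<Rightarrow> nat) \<Rightarrow> (nat \<Rightarrow> nat \<Rightarrow> nat) \<Rightarrow> bool" where
  "bounded_spacers q a \<longleftrightarrow> (\<exists>K. \<forall>n. \<forall>i<q n. a n i \<le> K)"

definition ferenczi_subshift :: "(nat \<Rightarrow> nat) \<Rightarrow> (nat \<Rightarrow> nat \<Rightarrow> nat) \<Rightarrow> (int \<Rightarrow> nat) set" where
  "ferenczi_subshift q a =
     {x. range x \<subseteq> {0, 1} \<and> (\<forall>u. is_factor u x \<longrightarrow> (\<exists>n. sublist u (generating_word q a n)))}"

text \<open>Eigenfunctions are functions on \<open>X\<close>, so their values outside \<open>X\<close> are ignored.\<close>

definition continuous_eigenvalue ::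
  "'a::topological_space set \<Rightarrow> ('a \<Rightarrow> 'a) \<Rightarrow> complex \<Rightarrow> bool" where
  "continuous_eigenvalue X T l \<longleftrightarrow>
     (\<exists>f. continuous_on X f \<and> (\<exists>x\<in>X. f x \<noteq> 0) \<and> (\<forall>x\<in>X. f (T x) = l * f x))"

definition continuous_irrational_eigenvalue ::
  "'a::topological_space set \<Rightarrow> ('a \<Rightarrow> 'a) \<Rightarrow> complex \<Rightarrow> bool" where
  "continuous_irrational_eigenvalue X T l \<longleftrightarrow> continuous_eigenvalue X T l \<and>
     (\<exists>\<alpha>::real. 0 \<le> \<alpha> \<and> \<alpha> < 1 \<and> \<alpha> \<notin> \<rat> \<and> l = exp (2 * of_real pi * \<i> * of_real \<alpha>))"

end

theory Submission
  imports Defs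
begin

text \<open>
  If \<open>f\<close> is a continuous eigenfunction for \<open>\<lambda>\<close> and \<open>f x \<noteq> 0\<close>, then a central window of \<open>x\<close> on which \<open>f\<close> is
  almost determined lies in some \<open>w\<^sub>n\<close>. This word occurs in \<open>x\<close> at positions that differ by
  \<open>|w\<^sub>n| + a\<^sub>m\<^sub>,\<^sub>i\<close> for all \<open>m \<ge> n\<close>, so all the powers of \<open>\<lambda>\<close> with these exponents are close to \<open>1\<close>. By
  aperiodicity the spacers from level \<open>n\<close> on take two distinct values, whose difference is bounded; hence
  some power \<open>\<lambda>\<^sup>d\<close> with bounded \<open>d > 0\<close> is close to \<open>1\<close>, and \<open>\<lambda>\<close> is a root of unity. For a root of unity of
  order \<open>q\<close>, being close to \<open>1\<close> means that \<open>q\<close> divides the exponent.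

  Conversely, if \<open>q\<close> divides all \<open>|w\<^sub>n| + a\<^sub>m\<^sub>,\<^sub>i\<close> with \<open>m \<ge> n\<close>, then the positions of the copies of \<open>w\<^sub>n\<close> in a
  point \<open>x\<close> all have the same residue \<open>\<rho> x\<close> modulo \<open>q\<close>, and \<open>x \<mapsto> \<lambda>\<^bsup>-\<rho> x\<^esup>\<close> is an eigenfunction. It is well
  defined and locally constant because these positions are determined by \<open>x\<close>: the sequence of spacers
  between copies of \<open>w\<^sub>n\<close> has a Toeplitz-like structure of period \<open>q\<^sub>n + 1\<close>, with a single free residue
  class, and two different choices of this class would make \<open>x\<close> periodic.
\<close>

section \<open>Words with inserted spacers\<close>

text \<open>The parameter \<open>f\<close> lets one definition serve twice: with \<open>ones\<close>
  it builds 0-1 words from copies of \<open>w\<close>, with \<open>single\<close> it builds lists of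
  spacers from shorter such lists.\<close>

definition interleave :: "'b list \<Rightarrow> ('a \<Rightarrow> 'b list) \<Rightarrow> 'a list \<Rightarrow> 'b list" where
  "interleave w f g = w @ concat (map (\<lambda>s. f s @ w) g)"

abbreviation ones :: "nat \<Rightarrow> nat list" where
  "ones s \<equiv> replicate s 1"

abbreviation single :: "'a \<Rightarrow> 'a list" where
  "single s \<equiv> [s]"

lemma interleave_Nil [simp]: "interleave w f [] = w"
  by (simp add: interleave_def)

lemma interleave_Cons [simp]: "interleave w f (s # g) = w @ f s @ interleave w f g"
  by (simp add: interleave_def)

lemma interleave_append:
  "interleave w f (g @ s # g') = interleave w f g @ f s @ interleave w f g'"
  by (induction g) auto

lemma interleave_empty_single: "interleave [] single g = g"
  by (induction g) auto

text \<open>Associativity of insertion: the gaps within each inner block are \<open>g\<close>, those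
  between blocks come from \<open>g'\<close>, so the gaps of the composite are themselves an
  interleaving.\<close>

lemma interleave_interleave:
  "interleave (interleave w f g) f g' = interleave w f (interleave g single g')"
  by (induction g') (auto simp: interleave_append)

lemma interleave_snoc_conv:
  "interleave w f g = concat (map (\<lambda>s. w @ f s) g) @ w"
  by (induction g) auto

lemma set_interleave_single: "set (interleave w single g) \<subseteq> set w \<union> set g"
  by (induction g) auto

lemma length_interleave_single:
  "length (interleave w single g) + 1 = (length w + 1) * (length g + 1)"
  by (induction g) auto

text \<open>The start of copy number \<open>l\<close>, counted from 0, of a word of length
  \<open>d\<close> inserted with gaps \<open>g\<close>. Beyond the end of \<open>g\<close> gaps
  count as 0, so that for \<open>d > 0\<close> the function increases strictly on all of
  \<open>nat\<close>.\<close>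

definition offset :: "nat \<Rightarrow> nat list \<Rightarrow> nat \<Rightarrow> nat" where
  "offset d g l = l * d + sum_list (take l g)"

lemma offset_0 [simp]: "offset d g 0 = 0"
  by (simp add: offset_def)

lemma offset_Cons_Suc [simp]: "offset d (s # g) (Suc l) = d + s + offset d g l"
  by (simp add: offset_def)

lemma offset_Suc: "l < length g \<Longrightarrow> offset d g (Suc l) = offset d g l + d + g ! l"
  by (simp add: offset_def take_Suc_conv_app_nth)

lemma strict_mono_offset:
  assumes "d > 0"
  shows "strict_mono (offset d g)"
proof (rule strict_mono_Suc_iff[THEN iffD2], rule allI)
  fix l
  show "offset d g l < offset d g (Suc l)"
    using assms by (cases "l < length g") (auto simp: offset_Suc, simp add: offset_def)
qed

lemma length_interleave_ones:
  "length (interleave w ones g) = offset (length w) g (length g) + length w"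
  by (induction g) auto

lemma nth_interleave_ones:
  assumes "l \<le> length g" "r < length w"
  shows "offset (length w) g l + r < length (interleave w ones g) \<and>
    interleave w ones g ! (offset (length w) g l + r) = w ! r"
  using assms(1)
proof (induction g arbitrary: l)
  case Nil
  then show ?case using assms(2) by simp
next
  case (Cons s g)
  show ?case
  proof (cases l)
    case 0
    then show ?thesis using assms(2) by (simp add: nth_append)
  next
    case (Suc l')
    with Cons show ?thesis by (auto simp: nth_append)
  qed
qed

text \<open>Spacers consist of ones, so the copies of \<open>w 0\<close> can be read off directly;
  this starts the recognition of copies at all levels.\<close>

lemma zero_of_interleave_ones_iff:
  "z < length (interleave [0] ones g) \<and> interleave [0] ones g ! z = 0
    \<longleftrightarrow> (\<exists>l\<le>length g. z = offset 1 g l)"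
proof (induction g arbitrary: z)
  case Nil
  then show ?case by auto
next
  case (Cons s g)
  consider "z = 0" | "0 < z" "z \<le> s" | "s < z" by linarith
  then show ?case
  proof cases
    case 1
    then show ?thesis by (auto intro: exI[of _ 0])
  next
    case 2
    then have "z \<noteq> offset 1 (s # g) l" for l
      by (cases l) auto
    with 2 show ?thesis
      by (auto simp: nth_append nth_Cons split: nat.splits)
  next
    case 3
    then obtain y where y: "z = Suc s + y"
      by (metis add_Suc less_imp_Suc_add)
    have "(\<exists>l\<le>length (s # g). z = offset 1 (s # g) l) \<longleftrightarrow> (\<exists>l\<le>length g. y = offset 1 g l)"
      (is "?A \<longleftrightarrow> ?B")
    proof
      assume ?A
      then obtain l where l: "l \<le> length (s # g)" "z = offset 1 (s # g) l" by auto
      with y obtain l' where "l = Suc l'" by (cases l) auto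
      with l y show ?B by auto
    next
      assume ?B
      then obtain l where "l \<le> length g" "y = offset 1 g l" by auto
      then show ?A using y by (intro exI[of _ "Suc l"]) auto
    qed
    with Cons.IH[of y] y show ?thesis by (simp add: nth_append)
  qed
qed

text \<open>Consecutive starts differ by at most \<open>d + K\<close>. The second premise keeps the
  window inside the interleaved word, whose length is
  \<open>offset d g (length g) + d\<close>.\<close>

lemma offset_syndetic:
  assumes "\<forall>s\<in>set g. s \<le> K" "z + d + K < offset d g (length g) + d"
  shows "\<exists>l\<le>length g. z \<le> offset d g l \<and> offset d g l \<le> z + d + K"
  using assms
proof (induction g arbitrary: z)
  case Nil
  then show ?case by simp
next
  case (Cons s g)
  consider "z = 0" | "0 < z" "z \<le> d + s" | "d + s < z" by linarith
  then show ?case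
  proof cases
    case 1
    then show ?thesis by (intro exI[of _ 0]) auto
  next
    case 2
    then show ?thesis using Cons.prems by (intro exI[of _ 1]) (auto simp: offset_def)
  next
    case 3
    then have "z - (d + s) + d + K < offset d g (length g) + d"
      using Cons.prems by auto
    then obtain l where "l \<le> length g" "z - (d + s) \<le> offset d g l"
      "offset d g l \<le> z - (d + s) + d + K"
      using Cons.IH[of "z - (d + s)"] Cons.prems by auto
    with 3 show ?thesis by (intro exI[of _ "Suc l"]) auto
  qed
qed

lemma sum_list_take_interleave_single:
  assumes "l \<le> length g" "i \<le> length w"
  shows "sum_list (take ((length w + 1) * l + i) (interleave w single g))
    = l * sum_list w + sum_list (take l g) + sum_list (take i w)"
  using assms(1)
proof (induction g arbitrary: l)
  case Nil
  then show ?case by simp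
next
  case (Cons s g)
  show ?case
  proof (cases l)
    case 0
    then show ?thesis using assms(2) by simp
  next
    case (Suc l')
    have e: "(length w + 1) * l + i = length w + Suc ((length w + 1) * l' + i)"
      using Suc by simp
    have "take (length w + Suc b) (interleave w single (s # g)) = w @ s # take b (interleave w single g)"
      for b by simp
    then show ?thesis unfolding e using Cons.IH[of l'] Cons.prems Suc
      by (simp add: add.assoc)
  qed
qed


section \<open>Bi-infinite sequences\<close>

lemma funpow_shift: "(shift ^^ k) x = (\<lambda>z. x (z + int k))"
  by (induction k) (auto simp: shift_def algebra_simps)

text \<open>A compactness argument: if every \<open>c\<close> in \<open>A\<close> failed from some
  threshold on, the largest threshold would exclude them all. It yields one residue that serves
  arbitrarily large windows.\<close>

lemma pigeonhole_antimono:
  fixes P :: "'m::linorder \<Rightarrow> 'a \<Rightarrow> bool"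
  assumes "finite A" "\<And>M. \<exists>c\<in>A. P M c" "\<And>M M' c. P M' c \<Longrightarrow> M \<le> M' \<Longrightarrow> P M c"
  shows "\<exists>c\<in>A. \<forall>M. P M c"
proof (rule ccontr)
  assume "\<not> ?thesis"
  then obtain m where m: "\<And>c. c \<in> A \<Longrightarrow> \<not> P (m c) c" by metis
  obtain c where c: "c \<in> A" "P (Max (m ` A)) c" using assms(2) by metis
  then have "m c \<le> Max (m ` A)" using assms(1) by simp
  then show False using m c assms(3) by blast
qed

lemma enumerate_int_set:
  fixes E :: "int set"
  assumes up: "\<And>z. \<exists>y\<ge>z. y \<in> E" and down: "\<And>z. \<exists>y\<le>z. y \<in> E"
  shows "\<exists>t :: int \<Rightarrow> int. strict_mono t \<and> range t = E"
proof -
  obtain e where e: "e \<in> E" using up by blast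
  define A where "A = {n. e + int n \<in> E}"
  define B where "B = {n. e - int n \<in> E}"
  have "\<exists>n\<ge>m. n \<in> A" for m
  proof -
    obtain y where "y \<ge> e + int m" "y \<in> E" using up by blast
    then show ?thesis unfolding A_def by (intro exI[of _ "nat (y - e)"]) auto
  qed
  then have infA: "infinite A" by (simp add: infinite_nat_iff_unbounded_le)
  have "\<exists>n\<ge>m. n \<in> B" for m
  proof -
    obtain y where "y \<le> e - int m" "y \<in> E" using down by blast
    then show ?thesis unfolding B_def by (intro exI[of _ "nat (e - y)"]) auto
  qed
  then have infB: "infinite B" by (simp add: infinite_nat_iff_unbounded_le)
  define t where "t k = (if k \<ge> (0::int) then e + int (enumerate A (nat k))
    else e - int (enumerate B (nat (- k))))" for k
  \<comment> \<open>The base point \<open>e\<close> belongs to both halves; \<open>t\<close> uses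
    \<open>enumerate B\<close> only at positive indices, so \<open>e\<close> is listed once.\<close>
  have B0: "enumerate B 0 = 0"
    unfolding enumerate_0 using e by (intro Least_eq_0) (simp add: B_def)
  have sA: "strict_mono (enumerate A)" and sB: "strict_mono (enumerate B)"
    using infA infB by (auto intro: strict_mono_enumerate)
  have "strict_mono t"
  proof (rule strict_monoI)
    fix k l :: int
    assume kl: "k < l"
    consider "0 \<le> k" | "k < 0" "0 \<le> l" | "l < 0" by linarith
    then show "t k < t l"
    proof cases
      case 1
      then show ?thesis using kl strict_monoD[OF sA, of "nat k" "nat l"] by (simp add: t_def)
    next
      case 2
      then show ?thesis using B0 strict_monoD[OF sB, of 0 "nat (- k)"] by (simp add: t_def)
    next
      case 3
      then show ?thesis using kl strict_monoD[OF sB, of "nat (- l)" "nat (- k)"]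
        by (simp add: t_def)
    qed
  qed
  moreover have "range t = E"
  proof (intro equalityI subsetI)
    fix y assume "y \<in> range t"
    then obtain k where k: "y = t k" by auto
    have "enumerate A (nat k) \<in> A" "enumerate B (nat (- k)) \<in> B"
      using infA infB by (auto intro: enumerate_in_set)
    then show "y \<in> E" unfolding k t_def A_def B_def by auto
  next
    fix y assume y: "y \<in> E"
    show "y \<in> range t"
    proof (cases "y \<ge> e")
      case True
      then have "nat (y - e) \<in> A" using y by (simp add: A_def)
      then obtain n where "enumerate A n = nat (y - e)"
        using range_enumerate[OF infA] by (metis imageE)
      then have "t (int n) = y" using True by (simp add: t_def)
      then show ?thesis by blast
    next
      case False
      then have "nat (e - y) \<in> B" using y by (simp add: B_def)
      then obtain n where n: "enumerate B n = nat (e - y)"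
        using range_enumerate[OF infB] by (metis imageE)
      with False B0 have "n > 0" by (cases n) auto
      with n False have "t (- int n) = y" by (simp add: t_def)
      then show ?thesis by blast
    qed
  qed
  ultimately show ?thesis by blast
qed

section \<open>Cylinder sets in the product topology\<close>

lemma open_contains_cylinder:
  fixes U :: "(int \<Rightarrow> 'b::topological_space) set"
  assumes "open U" "x \<in> U"
  shows "\<exists>N. \<forall>y. (\<forall>z. \<bar>z\<bar> \<le> N \<longrightarrow> y z = x z) \<longrightarrow> y \<in> U"
proof -
  have "openin (product_topology (\<lambda>_. euclidean) UNIV) U"
    using assms(1) by (simp add: euclidean_product_topology)
  from product_topology_open_contains_basis[OF this assms(2)] obtain V where
    V: "x \<in> Pi\<^sub>E UNIV V" "finite {i. V i \<noteq> UNIV}" "Pi\<^sub>E UNIV V \<subseteq> U"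
    by auto
  define N where "N = Max (insert 0 (abs ` {i. V i \<noteq> UNIV}))"
  have "y \<in> U" if "\<forall>z. \<bar>z\<bar> \<le> N \<longrightarrow> y z = x z" for y
  proof -
    have "y i \<in> V i" for i
    proof (cases "V i = UNIV")
      case False
      then have "\<bar>i\<bar> \<le> N" unfolding N_def using V(2) by (intro Max_ge) auto
      then show ?thesis using that V(1) by (metis PiE_mem UNIV_I)
    qed simp
    then show ?thesis using V(3) by auto
  qed
  then show ?thesis by blast
qed

lemma open_cylinder:
  fixes x :: "int \<Rightarrow> 'b::discrete_topology"
  shows "open {y. \<forall>z. \<bar>z\<bar> \<le> (N::int) \<longrightarrow> y z = x z}"
proof -
  have "open (Pi\<^sub>E UNIV (\<lambda>z. if \<bar>z\<bar> \<le> N then {x z} else UNIV))"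
  proof (rule open_PiE)
    show "finite {i. (if \<bar>i\<bar> \<le> N then {x i} else UNIV) \<noteq> UNIV}"
      by (rule finite_subset[of _ "{- N..N}"]) (auto split: if_splits)
  qed (auto intro: open_discrete)
  also have "Pi\<^sub>E UNIV (\<lambda>z. if \<bar>z\<bar> \<le> N then {x z} else UNIV) = {y. \<forall>z. \<bar>z\<bar> \<le> N \<longrightarrow> y z = x z}"
    by (auto simp: PiE_iff split: if_splits)
  finally show ?thesis .
qed


section \<open>Ferenczi subshifts\<close>

locale aperiodic_ferenczi =
  fixes cut :: "nat \<Rightarrow> nat" and a :: "nat \<Rightarrow> nat \<Rightarrow> nat" and K :: nat
  assumes cut_ge_2: "cut n \<ge> 2"
    and spacer_le: "i < cut n \<Longrightarrow> a n i \<le> K"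
    and not_periodic: "x \<in> ferenczi_subshift cut a \<Longrightarrow> \<not> shift_periodic x"
begin

abbreviation w :: "nat \<Rightarrow> nat list" where
  "w \<equiv> generating_word cut a"

abbreviation h :: "nat \<Rightarrow> nat" where
  "h n \<equiv> length (w n)"

abbreviation X :: "(int \<Rightarrow> nat) set" where
  "X \<equiv> ferenczi_subshift cut a"

definition spacers :: "nat \<Rightarrow> nat list" where
  "spacers n = map (a n) [0..<cut n]"

text \<open>The spacers between consecutive copies of \<open>w n\<close> in \<open>w (n + k)\<close>.\<close>

primrec gaps :: "nat \<Rightarrow> nat \<Rightarrow> nat list" where
  "gaps n 0 = []"
| "gaps n (Suc k) = interleave (gaps n k) single (spacers (n + k))"

abbreviation pos :: "nat \<Rightarrow> nat \<Rightarrow> nat \<Rightarrow> nat" where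
  "pos n k l \<equiv> offset (h n) (gaps n k) l"

lemma length_spacers [simp]: "length (spacers n) = cut n"
  by (simp add: spacers_def)

lemma set_spacers: "s \<in> set (spacers n) \<longleftrightarrow> (\<exists>i<cut n. s = a n i)"
  by (auto simp: spacers_def)

lemma w_Suc: "w (Suc n) = interleave (w n) ones (spacers n)"
  by (simp add: interleave_snoc_conv spacers_def o_def)

declare generating_word.simps(2) [simp del]

lemma w_add: "w (n + k) = interleave (w n) ones (gaps n k)"
  by (induction k) (auto simp: w_Suc interleave_interleave)

text \<open>The defining recursion adds the coarsest level; this form peels off the finest one. It
  shows the Toeplitz-like pattern: \<open>spacers n\<close> repeats, and one entry in every
  \<open>cut n + 1\<close> is left to higher levels.\<close>

lemma gaps_Suc: "gaps n (Suc k) = interleave (spacers n) single (gaps (Suc n) k)"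
proof (induction k)
  case 0
  then show ?case by (simp add: interleave_empty_single)
next
  case (Suc k)
  have "gaps n (Suc (Suc k)) = interleave (gaps n (Suc k)) single (spacers (n + Suc k))"
    by simp
  also have "\<dots> = interleave (spacers n) single (gaps (Suc n) (Suc k))"
    unfolding Suc interleave_interleave by simp
  finally show ?case .
qed

lemma set_gaps: "s \<in> set (gaps n k) \<Longrightarrow> \<exists>m\<ge>n. \<exists>i<cut m. s = a m i"
proof (induction k)
  case (Suc k)
  then consider "s \<in> set (gaps n k)" | "s \<in> set (spacers (n + k))"
    using set_interleave_single[of "gaps n k" "spacers (n + k)"] by auto
  then show ?case
  proof cases
    case 2
    then show ?thesis by (intro exI[of _ "n + k"]) (simp add: set_spacers)
  qed (rule Suc.IH)
qed simp

lemma gaps_le: "\<forall>s\<in>set (gaps n k). s \<le> K"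
  using set_gaps spacer_le by blast

lemma length_gaps_Suc:
  "length (gaps n (Suc k)) + 1 = (cut n + 1) * (length (gaps (Suc n) k) + 1)"
  unfolding gaps_Suc by (simp only: length_interleave_single length_spacers)

lemma h_Suc: "h (Suc n) = (cut n + 1) * h n + sum_list (spacers n)"
  unfolding w_Suc length_interleave_ones by (simp add: offset_def)

lemma h_pos: "h n > 0"
  by (induction n) (auto simp: h_Suc)

lemma h_strict_mono: "strict_mono h"
proof (rule strict_mono_Suc_iff[THEN iffD2], rule allI)
  fix n
  show "h n < h (Suc n)" using h_pos[of n] cut_ge_2[of n] by (simp add: h_Suc)
qed

text \<open>The copies of \<open>w n\<close> come in groups of \<open>cut n + 1\<close>, one group
  for each copy of \<open>w (Suc n)\<close>, with the same relative positions in every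
  group.\<close>

lemma pos_Suc:
  assumes "l \<le> length (gaps (Suc n) k)" "i \<le> cut n"
  shows "pos n (Suc k) ((cut n + 1) * l + i) = pos (Suc n) k l + offset (h n) (spacers n) i"
  using sum_list_take_interleave_single[OF assms(1), of i "spacers n"] assms(2)
  unfolding gaps_Suc offset_def h_Suc by (simp add: algebra_simps)

lemma nth_w_pos:
  assumes "l \<le> length (gaps n k)" "r < h n"
  shows "pos n k l + r < h (n + k)" "w (n + k) ! (pos n k l + r) = w n ! r"
  using nth_interleave_ones[OF assms] by (auto simp: w_add)

text \<open>The index \<open>j\<close> is the place in \<open>w m\<close> that lies over coordinate
  0 of \<open>x\<close>. For negative \<open>M\<close> the condition is empty.\<close>

definition agrees :: "(int \<Rightarrow> nat) \<Rightarrow> int \<Rightarrow> nat \<Rightarrow> int \<Rightarrow> bool" where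
  "agrees x M m j \<longleftrightarrow>
    (\<forall>z. \<bar>z\<bar> \<le> M \<longrightarrow> 0 \<le> z + j \<and> z + j < int (h m) \<and> x z = w m ! nat (z + j))"

text \<open>With \<open>J = UNIV\<close> this holds for every point of \<open>X\<close>; with
  \<open>J\<close> a residue class it records a phase of \<open>x\<close> modulo
  \<open>q\<close>.\<close>

definition approximable :: "int set \<Rightarrow> (int \<Rightarrow> nat) \<Rightarrow> bool" where
  "approximable J x \<longleftrightarrow> (\<forall>M. \<exists>m j. j \<in> J \<and> agrees x M m j)"

lemma agrees_antimono: "agrees x M' m j \<Longrightarrow> M \<le> M' \<Longrightarrow> agrees x M m j"
  by (auto simp: agrees_def)

lemma approximable_UNIV:
  assumes "x \<in> X"
  shows "approximable UNIV x"
  unfolding approximable_def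
proof
  fix M :: int
  show "\<exists>m j. j \<in> UNIV \<and> agrees x M m j"
  proof (cases "M \<ge> 0")
    case False
    then have "agrees x M 0 0" by (auto simp: agrees_def)
    then show ?thesis by blast
  next
    case True
    define u where "u = map (\<lambda>i. x (- M + int i)) [0..<nat (2 * M + 1)]"
    have lu: "length u = nat (2 * M + 1)" by (simp add: u_def)
    have "is_factor u x" unfolding is_factor_def lu u_def by (rule exI[of _ "- M"]) simp
    then obtain m where "sublist u (w m)" using assms unfolding ferenczi_subshift_def by auto
    then obtain ps ss where wm: "w m = ps @ u @ ss" by (auto simp: sublist_def)
    \<comment> \<open>The window starts at coordinate \<open>- M\<close>, which lies over index
      \<open>length ps\<close>; hence coordinate 0 lies over \<open>length ps + M\<close>.\<close>
    have "agrees x M m (int (length ps) + M)"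
      unfolding agrees_def
    proof (intro allI impI)
      fix z assume z: "\<bar>z\<bar> \<le> M"
      have n: "nat (z + (int (length ps) + M)) = length ps + nat (z + M)" using z by auto
      have zM: "0 \<le> z + M" using z by simp
      have nz: "nat (z + M) < length u" using z lu by auto
      have "w m ! nat (z + (int (length ps) + M)) = u ! nat (z + M)"
        unfolding n wm using nz by (simp add: nth_append)
      also have "\<dots> = x z" using zM nz lu nth_upt[of 0 "nat (z + M)" "nat (2 * M + 1)"]
        by (simp add: u_def del: nth_upt)
      finally show "0 \<le> z + (int (length ps) + M) \<and> z + (int (length ps) + M) < int (h m)
          \<and> x z = w m ! nat (z + (int (length ps) + M))"
        using z zM lu by (simp add: wm)
    qed
    then show ?thesis by blast
  qed
qed

lemma shift_in_X: "x \<in> X \<Longrightarrow> shift x \<in> X"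
proof -
  assume x: "x \<in> X"
  have "is_factor u x" if "is_factor u (shift x)" for u
  proof -
    obtain k where k: "u = map (\<lambda>j. shift x (k + int j)) [0..<length u]"
      using \<open>is_factor u (shift x)\<close> unfolding is_factor_def by blast
    have eq: "(\<lambda>j. shift x (k + int j)) = (\<lambda>j. x (k + 1 + int j))"
      by (auto simp: shift_def algebra_simps)
    show ?thesis unfolding is_factor_def by (rule exI[of _ "k + 1"], rule k[unfolded eq])
  qed
  moreover have "range (shift x) \<subseteq> range x" by (auto simp: shift_def)
  ultimately show ?thesis
    using x unfolding ferenczi_subshift_def mem_Collect_eq by (meson subset_trans)
qed

lemma funpow_shift_in_X: "x \<in> X \<Longrightarrow> (shift ^^ k) x \<in> X"
  by (induction k) (auto simp: shift_in_X)

lemma w_occurs: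
  assumes "x \<in> X"
  shows "\<exists>y. z \<le> y \<and> y \<le> z + int (h n + K) \<and> (\<forall>r<h n. x (y + int r) = w n ! r)"
proof -
  \<comment> \<open>The window contains the interval searched and a full copy of \<open>w n\<close>
    after it, and it is longer than \<open>w n\<close>, which forces \<open>n < m\<close>.\<close>
  define M where "M = \<bar>z\<bar> + 2 * int (h n) + int K + 1"
  obtain m j where mj: "agrees x M m j"
    using approximable_UNIV[OF assms] unfolding approximable_def by blast
  have ag: "0 \<le> y + j" "y + j < int (h m)" "x y = w m ! nat (y + j)" if "\<bar>y\<bar> \<le> M" for y
    using mj that unfolding agrees_def by auto
  have "0 \<le> - M + j" "M + j < int (h m)" using ag(1)[of "- M"] ag(2)[of M]
    by (auto simp: M_def)
  then have "h n < h m" by (simp add: M_def)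
  then have "n < m" using strict_mono_less[OF h_strict_mono] by blast
  then obtain k where m: "m = n + k" using less_imp_add_positive by blast
  have zj: "0 \<le> z + j" using ag(1)[of z] by (auto simp: M_def)
  have "z + j + int (h n + K) < int (h m)"
    using \<open>M + j < int (h m)\<close> by (simp add: M_def)
  then have "nat (z + j) + h n + K < h m" using zj by linarith
  then have "nat (z + j) + h n + K < pos n k (length (gaps n k)) + h n"
    by (simp only: m w_add length_interleave_ones)
  from offset_syndetic[OF gaps_le this] obtain l where
    l: "l \<le> length (gaps n k)" "nat (z + j) \<le> pos n k l" "pos n k l \<le> nat (z + j) + h n + K"
    by auto
  define y where "y = int (pos n k l) - j"
  have "x (y + int r) = w n ! r" if r: "r < h n" for r
  proof -
    have "\<bar>y + int r\<bar> \<le> M" unfolding M_def y_def using l r zj by linarith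
    then have "x (y + int r) = w m ! nat (y + int r + j)" by (rule ag(3))
    also have "nat (y + int r + j) = pos n k l + r" by (simp add: y_def)
    finally show ?thesis using nth_w_pos[OF l(1) r] m by simp
  qed
  moreover have "z \<le> y" "y \<le> z + int (h n + K)"
    unfolding y_def using l zj by linarith+
  ultimately show ?thesis by blast
qed

section \<open>Zeros and periods of points of the subshift\<close>

lemma enumerate_zeros:
  assumes "x \<in> X"
  shows "\<exists>t. strict_mono t \<and> (\<forall>z. x z = 0 \<longleftrightarrow> z \<in> range (t :: int \<Rightarrow> int))"
proof -
  have z: "\<exists>y. z \<le> y \<and> y \<le> z + int (1 + K) \<and> x y = 0" for z
    using w_occurs[OF assms, of z 0] by auto
  have "\<exists>y\<ge>z. y \<in> {y. x y = 0}" "\<exists>y\<le>z. y \<in> {y. x y = 0}" for z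
    using z[of z] z[of "z - int (1 + K)"] by auto
  then obtain t :: "int \<Rightarrow> int" where "strict_mono t" "range t = {y. x y = 0}"
    using enumerate_int_set by blast
  then show ?thesis by (intro exI[of _ t]) auto
qed

lemma not_shift_invariant:
  assumes "x \<in> X" "P > 0" "\<And>z. x (z + P) = x z"
  shows False
proof -
  have "(shift ^^ nat P) x = x" using assms(2,3) by (auto simp: funpow_shift)
  then have "shift_periodic x" using assms(2) unfolding shift_periodic_def
    by (intro exI[of _ "nat P"]) auto
  then show False using not_periodic assms(1) by blast
qed

section \<open>Recognizability\<close>

text \<open>If \<open>t\<close> lists the starting points of the copies of \<open>w n\<close>, then every \<open>cut n + 1\<close> of them, counted
  from the residue \<open>c\<close>, form a copy of \<open>w (n + 1)\<close>; the constants \<open>d i\<close> are their relative positions.\<close>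

inductive tower :: "(int \<Rightarrow> int) \<Rightarrow> nat \<Rightarrow> (int \<Rightarrow> int) \<Rightarrow> bool" for t0 where
  tower_0: "tower t0 0 t0"
| tower_Suc: "tower t0 n t \<Longrightarrow>
    (\<And>k i. i \<le> cut n \<Longrightarrow> t ((int (cut n) + 1) * k + c + int i) = t ((int (cut n) + 1) * k + c) + d i) \<Longrightarrow>
    tower t0 (Suc n) (\<lambda>k. t ((int (cut n) + 1) * k + c))"

lemma tower_strict_mono: "tower t0 n t \<Longrightarrow> strict_mono t0 \<Longrightarrow> strict_mono t"
proof (induction rule: tower.induct)
  case (tower_Suc n t c d)
  then have "strict_mono t" by simp
  then show ?case by (auto intro!: strict_monoI elim: strict_monoD)
qed

text \<open>Blocks repeat the same relative positions, so a period \<open>e\<close> of the list at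
  level \<open>n + 1\<close> becomes the period \<open>(cut n + 1) * e\<close> at level
  \<open>n\<close>, with the same translation \<open>P\<close>.\<close>

lemma tower_periodic:
  assumes "tower t0 n t" "\<And>k. t (k + e) = t k + P"
  shows "\<exists>e. \<forall>k. t0 (k + e) = t0 k + P"
  using assms
proof (induction arbitrary: e rule: tower.induct)
  case tower_0
  then show ?case by blast
next
  case (tower_Suc n t c d)
  define p where "p = int (cut n) + 1"
  have "t (y + p * e) = t y + P" for y
  proof -
    define k where "k = (y - c) div p"
    define i where "i = nat ((y - c) mod p)"
    have p: "p > 0" by (simp add: p_def)
    then have i: "i \<le> cut n" using pos_mod_bound[of p "y - c"] by (simp add: i_def p_def)
    have y: "y = p * k + c + int i"
      using p by (simp add: i_def k_def)
    have "t (y + p * e) = t (p * (k + e) + c + int i)" by (simp add: y algebra_simps)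
    also have "\<dots> = t (p * k + c + int i) + P"
      using tower_Suc.hyps(2)[OF i, of k] tower_Suc.hyps(2)[OF i, of "k + e"]
        tower_Suc.prems[of k] by (simp flip: p_def)
    finally show ?thesis by (simp flip: y)
  qed
  then show ?case by (rule tower_Suc.IH)
qed

text \<open>The periodicity descends to the zeros of \<open>x\<close>, and over a two-letter
  alphabet these determine \<open>x\<close>.\<close>

lemma tower_not_periodic:
  assumes x: "x \<in> X" and t0: "strict_mono t0" "\<And>z. x z = 0 \<longleftrightarrow> z \<in> range t0"
    and t: "tower t0 n t" "\<And>k. t (k + e) = t k + P" and P: "P > 0"
  shows False
proof -
  obtain e' where e': "\<And>k. t0 (k + e') = t0 k + P"
    using tower_periodic[OF t] by blast
  have "x (z + P) = 0 \<longleftrightarrow> x z = 0" for z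
  proof
    assume "x (z + P) = 0"
    then obtain k where "z + P = t0 k" using t0 by auto
    then have "z = t0 (k - e')" using e'[of "k - e'"] by simp
    then show "x z = 0" using t0 by auto
  next
    assume "x z = 0"
    then obtain k where "z = t0 k" using t0 by auto
    then have "z + P = t0 (k + e')" using e' by simp
    then show "x (z + P) = 0" using t0 by auto
  qed
  moreover have "x z \<in> {0, 1}" for z using x unfolding ferenczi_subshift_def by auto
  ultimately have "x (z + P) = x z" for z by (metis empty_iff insert_iff)
  then show False using not_shift_invariant x P by blast
qed

text \<open>Two different residues for the cuts would make every gap between copies of \<open>w n\<close> repeat with
  period \<open>cut n + 1\<close>.\<close>

lemma tower_unique:
  assumes x: "x \<in> X" and t0: "strict_mono t0" "\<And>z. x z = 0 \<longleftrightarrow> z \<in> range t0"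
    and "tower t0 n t" "tower t0 n t'"
  shows "\<exists>m. \<forall>k. t' k = t (k + m)"
  using assms(4,5)
proof (induction n arbitrary: t t')
  case 0
  then have "t = t0" "t' = t0" by (auto elim: tower.cases)
  then show ?case by (intro exI[of _ 0]) simp
next
  case (Suc n)
  define p where "p = int (cut n) + 1"
  have p: "p > 0" by (simp add: p_def)
  obtain u c d where u: "tower t0 n u" "t = (\<lambda>k. u (p * k + c))"
    and d: "\<And>k i. i \<le> cut n \<Longrightarrow> u (p * k + c + int i) = u (p * k + c) + d i"
    using Suc.prems(1) unfolding p_def by cases auto
  obtain u' c' d' where u': "tower t0 n u'" "t' = (\<lambda>k. u' (p * k + c'))"
    and d': "\<And>k i. i \<le> cut n \<Longrightarrow> u' (p * k + c' + int i) = u' (p * k + c') + d' i"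
    using Suc.prems(2) unfolding p_def by cases auto
  obtain m where m: "\<And>k. u' k = u (k + m)" using Suc.IH[OF u(1) u'(1)] by blast
  show ?case
  \<comment> \<open>In the indexing of \<open>u\<close>, the list \<open>t\<close> cuts at the
    residue \<open>c\<close> and \<open>t'\<close> at \<open>c' + m\<close>.\<close>
  proof (cases "p dvd c' + m - c")
    case True
    then obtain b where b: "c' + m - c = p * b" by blast
    have "t' k = t (k + b)" for k
    proof -
      have "p * k + c' + m = p * (k + b) + c" using b by (simp add: algebra_simps)
      then show ?thesis by (simp add: u u' m)
    qed
    then show ?thesis by blast
  next
    case False
    \<comment> \<open>Either block structure leaves free only the gap at the end of its blocks. The
      two free residue classes differ, so at least one of the structures determines the gap.\<close>
    have step: "u (y + p + 1) - u (y + p) = u (y + 1) - u y" for y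
    proof -
      have *: "u (p * (k + 1) + b + int i + 1) - u (p * (k + 1) + b + int i)
          = u (p * k + b + int i + 1) - u (p * k + b + int i)"
        if dd: "\<And>k i. i \<le> cut n \<Longrightarrow> u (p * k + b + int i) = u (p * k + b) + f i"
          and i: "i < cut n" for k i b f
        using dd[of i k] dd[of "Suc i" k] dd[of i "k + 1"] dd[of "Suc i" "k + 1"] i
        by (simp add: add.assoc add.commute add.left_commute)
      have **: "u (y + p + 1) - u (y + p) = u (y + 1) - u y"
        if dd: "\<And>k i. i \<le> cut n \<Longrightarrow> u (p * k + b + int i) = u (p * k + b) + f i"
          and nd: "\<not> p dvd y + 1 - b" for b f
      proof -
        define k where "k = (y - b) div p"
        define i where "i = nat ((y - b) mod p)"
        have y: "y = p * k + b + int i" using p by (simp add: i_def k_def)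
        have "int i < p" using p by (simp add: i_def)
        moreover have "int i \<noteq> int (cut n)"
        proof
          assume "int i = int (cut n)"
          then have "y + 1 - b = p * (k + 1)" unfolding y p_def by (simp add: algebra_simps)
          then show False using nd by simp
        qed
        ultimately have "i < cut n" by (simp add: p_def)
        from *[OF dd this, of k] show ?thesis unfolding y by (simp add: algebra_simps)
      qed
      show ?thesis
      proof (cases "p dvd y + 1 - c")
        case True
        have "\<not> p dvd y + 1 - (c' + m)"
        proof
          assume "p dvd y + 1 - (c' + m)"
          with True have "p dvd (y + 1 - c) - (y + 1 - (c' + m))" by (rule dvd_diff)
          moreover have "(y + 1 - c) - (y + 1 - (c' + m)) = c' + m - c" by simp
          ultimately show False using \<open>\<not> p dvd c' + m - c\<close> by metis
        qed
        moreover have "u (p * k + (c' + m) + int i) = u (p * k + (c' + m)) + d' i"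
          if "i \<le> cut n" for k i
          using d'[OF that, of k] unfolding m by (simp add: algebra_simps)
        ultimately show ?thesis using **[of "c' + m" d'] by blast
      next
        case False
        then show ?thesis using **[of c d] d by blast
      qed
    qed
    define P where "P = u p - u 0"
    \<comment> \<open>By \<open>step\<close> the left side has zero increments in \<open>k\<close>,
      so it keeps its value at 0.\<close>
    have "u (k + p) - u k = P" for k
    proof (induction k rule: int_induct[of _ 0])
      case base
      then show ?case by (simp add: P_def)
    next
      case (step1 i)
      then show ?case using \<open>u (i + p + 1) - u (i + p) = u (i + 1) - u i\<close>
        by (simp add: algebra_simps)
    next
      case (step2 i)
      then show ?case using step[of "i - 1"] by (simp add: algebra_simps)
    qed
    then have "\<And>k. u (k + p) = u k + P" by (simp add: algebra_simps)
    moreover have "P > 0"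
      using strict_monoD[OF tower_strict_mono[OF u(1) t0(1)] p] by (simp add: P_def)
    ultimately show ?thesis using tower_not_periodic[OF x t0 u(1)] by blast
  qed
qed

text \<open>The positions listed by \<open>t\<close> are, locally and up to a translation in \<open>J\<close>, those of the copies of
  \<open>w n\<close> in some \<open>w (n + k)\<close>.\<close>

definition admissible :: "int set \<Rightarrow> nat \<Rightarrow> (int \<Rightarrow> int) \<Rightarrow> bool" where
  "admissible J n t \<longleftrightarrow> (\<forall>M. \<exists>k j c. j \<in> J \<and>
    (\<forall>i. \<bar>i\<bar> \<le> M \<longrightarrow> 0 \<le> i + c \<and> i + c \<le> int (length (gaps n k)) \<and>
      t i + j = int (pos n k (nat (i + c)))))"

section \<open>Construction of towers\<close>

lemma admissible_0:
  assumes x: "approximable J x" and t: "strict_mono t" "\<And>z. x z = 0 \<longleftrightarrow> z \<in> range t"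
  shows "admissible J 0 t"
  unfolding admissible_def
proof
  fix M :: int
  show "\<exists>k j c. j \<in> J \<and>
    (\<forall>i. \<bar>i\<bar> \<le> M \<longrightarrow> 0 \<le> i + c \<and> i + c \<le> int (length (gaps 0 k)) \<and>
      t i + j = int (pos 0 k (nat (i + c))))"
  proof (cases "M \<ge> 0")
    case False
    then show ?thesis using x unfolding approximable_def by auto
  next
    case True
    \<comment> \<open>Since \<open>t\<close> is increasing, this window contains all zeros from
      \<open>t (- M)\<close> to \<open>t M\<close>.\<close>
    define N where "N = \<bar>t (- M)\<bar> + \<bar>t M\<bar>"
    obtain m j where j: "j \<in> J" and ag: "agrees x N m j"
      using x unfolding approximable_def by blast
    define g where "g = gaps 0 m"
    have wm: "w m = interleave [0] ones g" using w_add[of 0 m] by (simp add: g_def)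
    have zero: "x z = 0 \<longleftrightarrow> (\<exists>l\<le>length g. z + j = int (offset 1 g l))" if "\<bar>z\<bar> \<le> N" for z
    proof -
      have "0 \<le> z + j" "z + j < int (h m)" "x z = w m ! nat (z + j)"
        using ag that unfolding agrees_def by auto
      then have "x z = 0 \<longleftrightarrow> (\<exists>l\<le>length g. nat (z + j) = offset 1 g l)"
        unfolding zero_of_interleave_ones_iff[symmetric] wm by auto
      also have "\<dots> \<longleftrightarrow> (\<exists>l\<le>length g. z + j = int (offset 1 g l))"
        using \<open>0 \<le> z + j\<close> by (auto simp: nat_eq_iff)
      finally show ?thesis .
    qed
    have tN: "\<bar>z\<bar> \<le> N" if "t (- M) \<le> z" "z \<le> t M" for z
      using that unfolding N_def by linarith
    have t_le: "t i \<le> t i' \<longleftrightarrow> i \<le> i'" and t_less: "t i < t i' \<longleftrightarrow> i < i'" for i i'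
      using t(1) by (auto simp: strict_mono_less_eq strict_mono_less)
    have off: "strict_mono (offset 1 g)" by (rule strict_mono_offset) simp
    have "x (t (- M)) = 0" using t by auto
    then obtain l0 where l0: "l0 \<le> length g" "t (- M) + j = int (offset 1 g l0)"
      using zero[of "t (- M)"] by (auto simp: N_def)
    \<comment> \<open>Once \<open>t (- M)\<close> lies over copy number \<open>l0\<close>,
      consecutive zeros of \<open>x\<close> must lie over consecutive copies of the letter
      0.\<close>
    have *: "l0 + b \<le> length g \<and> t (- M + int b) + j = int (offset 1 g (l0 + b))"
      if "int b \<le> 2 * M" for b
      using that
    proof (induction b)
      case 0
      then show ?case using l0 by simp
    next
      case (Suc b)
      then have IH: "l0 + b \<le> length g" "t (- M + int b) + j = int (offset 1 g (l0 + b))" by auto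
      let ?i = "- M + int (Suc b)"
      have ti: "t (- M) \<le> t ?i" "t ?i \<le> t M" "t (- M) \<le> t (- M + int b)"
        using Suc.prems by (simp_all add: t_le)
      have "x (t ?i) = 0" using t by auto
      then obtain l where l: "l \<le> length g" "t ?i + j = int (offset 1 g l)"
        using zero[OF tN[OF ti(1,2)]] by auto
      have "t (- M + int b) < t ?i" by (simp add: t_less)
      then have "offset 1 g (l0 + b) < offset 1 g l" using l(2) IH(2) by linarith
      then have "Suc (l0 + b) \<le> l" using strict_mono_less[OF off] by (simp add: Suc_le_eq)
      then have le: "offset 1 g (Suc (l0 + b)) \<le> offset 1 g l"
        using strict_mono_less_eq[OF off] by blast
      \<comment> \<open>The next zero of \<open>w m\<close>, in the coordinates of \<open>x\<close>,
        comes after the last matched zero and not after \<open>t ?i\<close>; as \<open>t\<close>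
        lists all zeros, it equals \<open>t ?i\<close>.\<close>
      define y where "y = int (offset 1 g (Suc (l0 + b))) - j"
      have y: "t (- M + int b) < y" "y \<le> t ?i"
        using IH(2) l(2) le strict_monoD[OF off, of "l0 + b" "Suc (l0 + b)"]
        unfolding y_def by auto
      have "\<bar>y\<bar> \<le> N" using tN[of y] y ti by linarith
      then have "x y = 0" using zero[of y] \<open>Suc (l0 + b) \<le> l\<close> l(1)
        by (auto simp: y_def intro!: exI[of _ "Suc (l0 + b)"])
      then obtain i where "y = t i" using t by auto
      then have "i = ?i" using y by (simp add: t_less t_le)
      then have "t ?i + j = int (offset 1 g (l0 + Suc b))" using \<open>y = t i\<close> y_def by simp
      then show ?case using \<open>Suc (l0 + b) \<le> l\<close> l(1) by simp
    qed
    show ?thesis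
    \<comment> \<open>Index \<open>- M\<close> corresponds to copy \<open>l0\<close>, so the index
      shift is \<open>l0 + M\<close>.\<close>
    proof (rule exI[of _ m], rule exI[of _ j], rule exI[of _ "int l0 + M"],
        intro conjI allI impI j)
      fix i assume "\<bar>i\<bar> \<le> M"
      then have i: "int (nat (i + M)) \<le> 2 * M" "- M + int (nat (i + M)) = i" "0 \<le> i + M" by auto
      have e: "nat (i + (int l0 + M)) = l0 + nat (i + M)" using i by simp
      show "0 \<le> i + (int l0 + M)" using i by simp
      show "i + (int l0 + M) \<le> int (length (gaps 0 m))"
        using *[OF i(1)] i(3) unfolding g_def by linarith
      show "t i + j = int (pos 0 m (nat (i + (int l0 + M))))"
        using *[OF i(1)] i(2) unfolding e g_def by simp
    qed
  qed
qed

text \<open>The indices at which copies of \<open>w (Suc n)\<close> begin may depend on the window,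
  but their residue modulo \<open>p\<close> takes finitely many values, so one residue
  \<open>c\<close> fits all windows. This makes the relative positions in a block independent of the
  block.\<close>

lemma admissible_refine:
  assumes "admissible J n t"
  defines "p \<equiv> int (cut n) + 1"
  shows "\<exists>c. \<forall>B. \<exists>k j e. j \<in> J \<and> (\<forall>b. \<bar>b\<bar> \<le> B \<longrightarrow>
    0 \<le> b + e \<and> b + e \<le> int (length (gaps (Suc n) k)) \<and>
    (\<forall>i\<le>cut n. t (p * b + c + int i) + j
      = int (pos (Suc n) k (nat (b + e)) + offset (h n) (spacers n) i)))"
proof -
  have p: "p > 0" by (simp add: p_def)
  have "\<exists>c0\<in>{0..<p}. \<forall>M. \<exists>k j c. j \<in> J \<and> p dvd c + c0 \<and>
    (\<forall>i. \<bar>i\<bar> \<le> M \<longrightarrow> 0 \<le> i + c \<and> i + c \<le> int (length (gaps n k)) \<and>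
      t i + j = int (pos n k (nat (i + c))))"
  proof (rule pigeonhole_antimono)
    fix M :: int
    obtain k j c where *: "j \<in> J" "\<forall>i. \<bar>i\<bar> \<le> M \<longrightarrow> 0 \<le> i + c \<and> i + c \<le> int (length (gaps n k)) \<and>
      t i + j = int (pos n k (nat (i + c)))"
      using assms(1) unfolding admissible_def by blast
    have "p dvd c + (- c) mod p" by (simp add: dvd_eq_mod_eq_0 mod_add_right_eq)
    moreover have "(- c) mod p \<in> {0..<p}" using p by simp
    ultimately show "\<exists>c0\<in>{0..<p}. \<exists>k j c. j \<in> J \<and> p dvd c + c0 \<and>
      (\<forall>i. \<bar>i\<bar> \<le> M \<longrightarrow> 0 \<le> i + c \<and> i + c \<le> int (length (gaps n k)) \<and>
        t i + j = int (pos n k (nat (i + c))))"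
      using * by blast
  qed (simp, meson order_trans)
  then obtain c0 where c0: "0 \<le> c0" "c0 < p"
    and c0_adm: "\<And>M. \<exists>k j c. j \<in> J \<and> p dvd c + c0 \<and>
      (\<forall>i. \<bar>i\<bar> \<le> M \<longrightarrow> 0 \<le> i + c \<and> i + c \<le> int (length (gaps n k)) \<and>
        t i + j = int (pos n k (nat (i + c))))"
    by auto
  have "\<exists>k j e. j \<in> J \<and> (\<forall>b. \<bar>b\<bar> \<le> B \<longrightarrow>
    0 \<le> b + e \<and> b + e \<le> int (length (gaps (Suc n) k)) \<and>
    (\<forall>i\<le>cut n. t (p * b + c0 + int i) + j
      = int (pos (Suc n) k (nat (b + e)) + offset (h n) (spacers n) i)))" for B
  proof -
    \<comment> \<open>Room for all indices \<open>p * b + c0 + i\<close>, as \<open>c0\<close> and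
      \<open>i\<close> are below \<open>p\<close>. Being positive, \<open>M\<close> also excludes
      \<open>k' = 0\<close>, where there is a single copy of \<open>w n\<close>.\<close>
    define M where "M = p * \<bar>B\<bar> + 2 * p"
    obtain k' j c where j: "j \<in> J" and "p dvd c + c0"
      and adm: "\<And>i. \<bar>i\<bar> \<le> M \<Longrightarrow> 0 \<le> i + c \<and> i + c \<le> int (length (gaps n k')) \<and>
        t i + j = int (pos n k' (nat (i + c)))"
      using c0_adm[of M] by blast
    then obtain e where e: "c + c0 = p * e" by blast
    have "M \<ge> 1" using p unfolding M_def by (simp add: add_increasing)
    then have "length (gaps n k') > 0" using adm[of "- M"] adm[of M] by linarith
    then obtain k where k: "k' = Suc k" by (cases k') auto
    have len: "int (length (gaps n k')) + 1 = p * (int (length (gaps (Suc n) k)) + 1)"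
      using length_gaps_Suc[of n k] unfolding k p_def
      by (metis of_nat_1 of_nat_add of_nat_mult)
    have "0 \<le> b + e \<and> b + e \<le> int (length (gaps (Suc n) k)) \<and>
      (\<forall>i\<le>cut n. t (p * b + c0 + int i) + j
        = int (pos (Suc n) k (nat (b + e)) + offset (h n) (spacers n) i))"
      if b: "\<bar>b\<bar> \<le> B" for b
    proof -
      have pb: "\<bar>p * b\<bar> \<le> p * \<bar>B\<bar>" unfolding abs_mult using p b by (simp add: mult_left_mono)
      have M: "\<bar>p * b + c0 + int i\<bar> \<le> M" if "i \<le> cut n" for i
      proof -
        have "int i < p" using that by (simp add: p_def)
        then show ?thesis using c0 pb unfolding M_def by linarith
      qed
      have eq: "p * b + c0 + int i + c = p * (b + e) + int i" for i
        using e by (simp add: algebra_simps)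
      have "0 \<le> p * (b + e)" using adm[OF M[of 0]] eq[of 0] by simp
      then have be: "0 \<le> b + e" using p by (simp add: zero_le_mult_iff)
      have "p * (b + e) + int (cut n) \<le> int (length (gaps n k'))"
        using adm[OF M[of "cut n"]] eq[of "cut n"] by simp
      then have "p * (b + e + 1) \<le> p * (int (length (gaps (Suc n) k)) + 1)"
        unfolding len[symmetric] by (simp add: p_def algebra_simps)
      then have le: "b + e \<le> int (length (gaps (Suc n) k))" using p by simp
      have "t (p * b + c0 + int i) + j
        = int (pos (Suc n) k (nat (b + e)) + offset (h n) (spacers n) i)"
        if i: "i \<le> cut n" for i
      proof -
        have "int ((cut n + 1) * nat (b + e) + i) = p * (b + e) + int i"
          using be by (simp add: p_def algebra_simps)
        then have "nat (p * b + c0 + int i + c) = (cut n + 1) * nat (b + e) + i"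
          unfolding eq by (metis nat_int)
        then show ?thesis
          using adm[OF M[OF i]] pos_Suc[of "nat (b + e)" n k i] le i unfolding k by simp
      qed
      then show ?thesis using be le by blast
    qed
    then show ?thesis using j by blast
  qed
  then show ?thesis by blast
qed

lemma admissible_Suc:
  assumes "tower t0 n t" "admissible J n t"
  shows "\<exists>t'. tower t0 (Suc n) t' \<and> admissible J (Suc n) t'"
proof -
  define p where "p = int (cut n) + 1"
  obtain c where c: "\<And>B. \<exists>k j e. j \<in> J \<and> (\<forall>b. \<bar>b\<bar> \<le> B \<longrightarrow>
    0 \<le> b + e \<and> b + e \<le> int (length (gaps (Suc n) k)) \<and>
    (\<forall>i\<le>cut n. t (p * b + c + int i) + j
      = int (pos (Suc n) k (nat (b + e)) + offset (h n) (spacers n) i)))"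
    using admissible_refine[OF assms(2)] unfolding p_def by blast
  have "t (p * b + c + int i) = t (p * b + c) + int (offset (h n) (spacers n) i)"
    if i: "i \<le> cut n" for b i
  proof -
    obtain k j e where "\<forall>i\<le>cut n. t (p * b + c + int i) + j
      = int (pos (Suc n) k (nat (b + e)) + offset (h n) (spacers n) i)"
      using c[of "\<bar>b\<bar>"] by blast
    from this[rule_format, OF i] this[rule_format, of 0] show ?thesis by simp
  qed
  then have "tower t0 (Suc n) (\<lambda>k. t (p * k + c))"
    unfolding p_def by (intro tower_Suc assms(1))
  moreover have "admissible J (Suc n) (\<lambda>k. t (p * k + c))"
    unfolding admissible_def
  proof
    fix M :: int
    obtain k j e where "j \<in> J" and *: "\<And>b. \<bar>b\<bar> \<le> M \<Longrightarrow>
      0 \<le> b + e \<and> b + e \<le> int (length (gaps (Suc n) k)) \<and>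
      (\<forall>i\<le>cut n. t (p * b + c + int i) + j
        = int (pos (Suc n) k (nat (b + e)) + offset (h n) (spacers n) i))"
      using c[of M] by blast
    moreover have "t (p * b + c) + j = int (pos (Suc n) k (nat (b + e)))" if "\<bar>b\<bar> \<le> M" for b
      using *[OF that, THEN conjunct2, THEN conjunct2, rule_format, of 0] by simp
    ultimately show "\<exists>k j e. j \<in> J \<and> (\<forall>b. \<bar>b\<bar> \<le> M \<longrightarrow>
      0 \<le> b + e \<and> b + e \<le> int (length (gaps (Suc n) k)) \<and>
      t (p * b + c) + j = int (pos (Suc n) k (nat (b + e))))"
      by blast
  qed
  ultimately show ?thesis by blast
qed

text \<open>The set \<open>J\<close> restricts only \<open>admissible\<close>, so towers obtained
  from different \<open>J\<close> can be compared by \<open>tower_unique\<close>.\<close>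

lemma tower_exists:
  assumes "approximable J x" "strict_mono t0" "\<And>z. x z = 0 \<longleftrightarrow> z \<in> range t0"
  shows "\<exists>t. tower t0 n t \<and> admissible J n t"
proof (induction n)
  case 0
  show ?case using admissible_0[OF assms] tower_0 by blast
next
  case (Suc n)
  then show ?case using admissible_Suc by blast
qed

text \<open>If all spacers from level \<open>n\<close> on were equal to \<open>s\<close>, the copies
  of \<open>w n\<close> in \<open>x\<close> would be equally spaced at distance
  \<open>h n + s\<close>, which is the case \<open>e = 1\<close> of
  \<open>tower_not_periodic\<close>.\<close>

lemma spacers_vary:
  assumes x: "x \<in> X"
  shows "\<exists>m\<ge>n. \<exists>i<cut m. \<exists>m'\<ge>n. \<exists>i'<cut m'. a m i < a m' i'"
proof (rule ccontr)
  assume "\<not> ?thesis"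
  then have le: "a m' i' \<le> a m i" if "m \<ge> n" "i < cut m" "m' \<ge> n" "i' < cut m'" for m i m' i'
    using that by (meson not_less)
  define s where "s = a n 0"
  have s: "a m i = s" if "m \<ge> n" "i < cut m" for m i
    unfolding s_def using le[of m i n 0] le[of n 0 m i] that cut_ge_2[of n] by simp
  obtain t0 where t0: "strict_mono t0" "\<And>z. x z = 0 \<longleftrightarrow> z \<in> range (t0 :: int \<Rightarrow> int)"
    using enumerate_zeros[OF x] by blast
  obtain t where t: "tower t0 n t" and adm: "admissible UNIV n t"
    using tower_exists[OF approximable_UNIV[OF x] t0] by blast
  have "t (b + 1) = t b + int (h n + s)" for b
  proof -
    obtain k j c where *: "\<And>i. \<bar>i\<bar> \<le> \<bar>b\<bar> + 1 \<Longrightarrow> 0 \<le> i + c \<and>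
      i + c \<le> int (length (gaps n k)) \<and> t i + j = int (pos n k (nat (i + c)))"
      using adm unfolding admissible_def by blast
    define l where "l = nat (b + c)"
    have b1: "\<bar>b + 1\<bar> \<le> \<bar>b\<bar> + 1" by linarith
    have bc: "0 \<le> b + c" "b + c + 1 \<le> int (length (gaps n k))"
      using *[of b] *[OF b1] by auto
    then have l: "l < length (gaps n k)" and e: "nat (b + 1 + c) = Suc l" by (auto simp: l_def)
    have "gaps n k ! l = s" using set_gaps nth_mem[OF l] s by metis
    then have "pos n k (Suc l) = pos n k l + h n + s" using offset_Suc[OF l] by simp
    then show ?thesis using *[of b] *[OF b1] unfolding e l_def[symmetric] by simp
  qed
  moreover have "int (h n + s) > 0" using h_pos[of n] by linarith
  ultimately show False using tower_not_periodic[OF x t0 t] by blast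
qed

section \<open>Residues of the positions of copies\<close>

lemma dvd_pos:
  assumes "\<forall>m\<ge>n. \<forall>i<cut m. q dvd int (h n + a m i)" "l \<le> length (gaps n k)"
  shows "q dvd int (pos n k l)"
  using assms(2)
proof (induction l)
  case (Suc l)
  then have l: "l < length (gaps n k)" by simp
  have "q dvd int (h n + gaps n k ! l)"
    using set_gaps[OF nth_mem[OF l]] assms(1) by auto
  then have "q dvd int (pos n k l) + int (h n + gaps n k ! l)"
    using Suc l by (intro dvd_add) auto
  then show ?case by (simp add: offset_Suc[OF l] add.assoc)
qed simp

text \<open>Approximations with \<open>q dvd j + r\<close> put all listed copies of
  \<open>w n\<close> at positions congruent to \<open>r\<close>. The two lists agree up to
  reindexing, so the residues coincide.\<close>

lemma residue_unique:
  assumes x: "x \<in> X" and q: "\<forall>m\<ge>n. \<forall>i<cut m. q dvd int (h n + a m i)"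
    and r: "approximable {j. q dvd j + r} x" and r': "approximable {j. q dvd j + r'} x"
  shows "q dvd r' - r"
proof -
  obtain t0 where t0: "strict_mono t0" "\<And>z. x z = 0 \<longleftrightarrow> z \<in> range (t0 :: int \<Rightarrow> int)"
    using enumerate_zeros[OF x] by blast
  obtain t where t: "tower t0 n t" "admissible {j. q dvd j + r} n t"
    using tower_exists[OF r t0] by blast
  obtain t' where t': "tower t0 n t'" "admissible {j. q dvd j + r'} n t'"
    using tower_exists[OF r' t0] by blast
  have dvd: "q dvd u b - c" if adm: "admissible {j. q dvd j + c} n u" for u b c
  proof -
    obtain k j e where j: "q dvd j + c" and *: "0 \<le> b + e"
      "b + e \<le> int (length (gaps n k))" "u b + j = int (pos n k (nat (b + e)))"
      using adm[unfolded admissible_def, rule_format, of "\<bar>b\<bar>"] by auto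
    then have "q dvd u b + j" using dvd_pos[OF q, of "nat (b + e)" k] by simp
    then have "q dvd (u b + j) - (j + c)" using j by (rule dvd_diff)
    then show ?thesis by simp
  qed
  obtain m where "t' 0 = t (0 + m)" using tower_unique[OF x t0 t(1) t'(1)] by blast
  then have "q dvd t m - r'" using dvd[OF t'(2), of 0] by simp
  from dvd_diff[OF dvd[OF t(2), of m] this] show ?thesis by simp
qed

section \<open>Continuous eigenvalues\<close>

text \<open>On the two sides of the spacer \<open>a m i\<close> stand the last copy of
  \<open>w n\<close> in one \<open>w m\<close> and the first copy in the next; their starts differ
  by \<open>h n + a m i\<close>.\<close>

lemma w_Suc_nth:
  assumes "n \<le> m" "i < cut m"
  shows "\<exists>c. c + (h n + a m i) + h n \<le> h (Suc m) \<and>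
    (\<forall>r<h n. w (Suc m) ! (c + r) = w n ! r \<and> w (Suc m) ! (c + (h n + a m i) + r) = w n ! r)"
proof -
  obtain k where m: "m = n + k" using assms(1) le_Suc_ex by blast
  define L where "L = pos n k (length (gaps n k))"
  define b where "b = offset (h m) (spacers m) i"
  have hm: "h m = L + h n" unfolding m L_def by (simp only: w_add length_interleave_ones)
  have o': "offset (h m) (spacers m) (Suc i) = b + h m + a m i"
    unfolding b_def using assms(2) by (simp add: offset_Suc) (simp add: spacers_def)
  have W: "w (Suc m) ! (offset (h m) (spacers m) l + r) = w m ! r" if "l \<le> cut m" "r < h m" for l r
    unfolding w_Suc using nth_interleave_ones[of l "spacers m" r "w m"] that by simp
  have "w (Suc m) ! (b + L + r) = w n ! r" "w (Suc m) ! (b + L + (h n + a m i) + r) = w n ! r"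
    if r: "r < h n" for r
  proof -
    have "w (Suc m) ! (b + (L + r)) = w m ! (L + r)"
      unfolding b_def using W[of i "L + r"] assms(2) r hm by simp
    then show "w (Suc m) ! (b + L + r) = w n ! r"
      using nth_w_pos(2)[OF le_refl r, of k] unfolding L_def m by (simp add: add.assoc)
    have "b + L + (h n + a m i) + r = offset (h m) (spacers m) (Suc i) + r"
      using o' hm by simp
    moreover have "w m ! r = w n ! r"
      using nth_w_pos(2)[OF le0 r, of k] unfolding m by simp
    ultimately show "w (Suc m) ! (b + L + (h n + a m i) + r) = w n ! r"
      using W[of "Suc i" r] assms(2) r hm by simp
  qed
  moreover have "b + L + (h n + a m i) + h n \<le> h (Suc m)"
  proof -
    have "offset (h m) (spacers m) (Suc i) + h m \<le> h (Suc m)"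
      unfolding w_Suc length_interleave_ones
      using strict_mono_less_eq[OF strict_mono_offset[OF h_pos]] assms(2)
      by (simp add: Suc_le_eq)
    then show ?thesis using o' hm by linarith
  qed
  ultimately show ?thesis by blast
qed

lemma eigenvalue_power_near_1:
  fixes f :: "(int \<Rightarrow> nat) \<Rightarrow> complex"
  assumes f: "continuous_on X f" "x \<in> X" "f x \<noteq> 0" "\<forall>x\<in>X. f (shift x) = l * f x"
    and l: "norm l = 1" and \<delta>: "\<delta> > 0"
  shows "\<exists>n. \<forall>m\<ge>n. \<forall>i<cut m. norm (l ^ (h n + a m i) - 1) < \<delta>"
proof -
  \<comment> \<open>Two approximations of \<open>f x\<close> are subtracted below, each with error
    less than \<epsilon>.\<close>
  define \<epsilon> where "\<epsilon> = \<delta> * norm (f x) / 2"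
  have "\<epsilon> > 0" using \<delta> f(3) by (simp add: \<epsilon>_def)
  then obtain U where U: "open U" "x \<in> U" "\<And>y. y \<in> X \<Longrightarrow> y \<in> U \<Longrightarrow> f y \<in> ball (f x) \<epsilon>"
    using f(1,2) unfolding continuous_on_topological by (meson centre_in_ball open_ball)
  obtain N' where N': "\<And>y. \<forall>z. \<bar>z\<bar> \<le> N' \<longrightarrow> y z = x z \<Longrightarrow> y \<in> U"
    using open_contains_cylinder[OF U(1,2)] by blast
  \<comment> \<open>Nonnegativity puts \<open>- N\<close> into the window, which gives
    \<open>j \<ge> 0\<close>.\<close>
  define N where "N = max 0 N'"
  have N: "norm (f y - f x) < \<epsilon>" if "y \<in> X" "\<And>z. \<bar>z\<bar> \<le> N \<Longrightarrow> y z = x z" for y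
    using U(3)[of y] N'[of y] that by (simp add: N_def dist_norm norm_minus_commute)
  obtain n j where ag: "agrees x N n j"
    using approximable_UNIV[OF f(2)] unfolding approximable_def by blast
  have j: "j \<ge> 0" using ag[unfolded agrees_def, rule_format, of "- N"] by (simp add: N_def)
  have fpow: "f ((shift ^^ k) x) = l ^ k * f x" for k
    by (induction k) (use f(2,4) funpow_shift_in_X in \<open>auto simp: mult.assoc\<close>)
  have "norm (l ^ (h n + a m i) - 1) < \<delta>" if mi: "m \<ge> n" "i < cut m" for m i
  proof -
    define d where "d = h n + a m i"
    obtain c where cd: "c + d + h n \<le> h (Suc m)"
      and c: "\<And>r. r < h n \<Longrightarrow> w (Suc m) ! (c + r) = w n ! r"
      "\<And>r. r < h n \<Longrightarrow> w (Suc m) ! (c + d + r) = w n ! r"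
      using w_Suc_nth[OF mi] unfolding d_def by blast
    obtain y where y: "0 \<le> y" "\<And>r. r < h (Suc m) \<Longrightarrow> x (y + int r) = w (Suc m) ! r"
      using w_occurs[OF f(2), of 0 "Suc m"] by blast
    \<comment> \<open>Shifting by \<open>A\<close> brings the first of the two copies of
      \<open>w n\<close> to the place where \<open>w n\<close> is read around the origin of
      \<open>x\<close>; shifting by \<open>A + d\<close> does so with the second.\<close>
    define A where "A = nat (y + int c + j)"
    have A: "int A = y + int c + j" using y(1) j by (simp add: A_def)
    have "x (z + int (A + b)) = x z" if z: "\<bar>z\<bar> \<le> N" and b: "b = 0 \<or> b = d" for z b
    proof -
      have zj: "0 \<le> z + j" "z + j < int (h n)" "x z = w n ! nat (z + j)"
        using ag z unfolding agrees_def by auto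
      define r where "r = nat (z + j)"
      have r: "r < h n" "int r = z + j" using zj by (auto simp: r_def)
      have "x (z + int (A + b)) = x (y + int (c + b + r))" using A r by (simp add: algebra_simps)
      also have "\<dots> = w (Suc m) ! (c + b + r)" using cd r(1) b by (intro y(2)) auto
      also have "\<dots> = x z" using c[OF r(1)] b zj(3) by (auto simp: r_def)
      finally show ?thesis .
    qed
    then have "norm (f ((shift ^^ (A + b)) x) - f x) < \<epsilon>" if "b = 0 \<or> b = d" for b
      using that by (intro N funpow_shift_in_X f(2)) (simp add: funpow_shift)
    from this[of 0] this[of d]
    have "norm (l ^ A * f x - f x) < \<epsilon>" "norm (l ^ (A + d) * f x - f x) < \<epsilon>"
      unfolding fpow by auto
    then have "norm ((l ^ (A + d) * f x - f x) - (l ^ A * f x - f x)) < 2 * \<epsilon>"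
      using norm_triangle_ineq4[of "l ^ (A + d) * f x - f x" "l ^ A * f x - f x"] by linarith
    also have "(l ^ (A + d) * f x - f x) - (l ^ A * f x - f x) = l ^ A * (l ^ d - 1) * f x"
      by (simp add: power_add algebra_simps)
    finally have "norm (l ^ d - 1) * norm (f x) < \<delta> * norm (f x)"
      by (simp add: norm_mult norm_power l \<epsilon>_def)
    then show ?thesis using f(3) by (simp add: d_def)
  qed
  then show ?thesis by blast
qed

lemma eigenvalue_root_of_unity:
  assumes f: "continuous_eigenvalue X shift l" and l: "norm l = 1"
  shows "\<exists>d>0. l ^ d = 1"
proof (rule ccontr)
  assume "\<not> ?thesis"
  then have nz: "l ^ d \<noteq> 1" if "d > 0" for d using that by blast
  obtain f x where f: "continuous_on X f" "x \<in> X" "f x \<noteq> 0" "\<forall>x\<in>X. f (shift x) = l * f x"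
    using assms(1) unfolding continuous_eigenvalue_def by blast
  \<comment> \<open>The element 1 keeps the set nonempty when \<open>K = 0\<close>. Its minimum is
    halved because two powers near 1 are subtracted.\<close>
  define D where "D = insert 1 ((\<lambda>d. norm (l ^ d - 1)) ` {1..K})"
  define \<delta> where "\<delta> = Min D / 2"
  have "\<forall>e\<in>D. e > 0" unfolding D_def using nz by auto
  then have "\<delta> > 0" unfolding \<delta>_def D_def by (subst zero_less_divide_iff) (auto simp: Min_gr_iff)
  then obtain n where n: "\<And>m i. m \<ge> n \<Longrightarrow> i < cut m \<Longrightarrow> norm (l ^ (h n + a m i) - 1) < \<delta>"
    using eigenvalue_power_near_1[OF f l] by blast
  obtain m i m' i' where mi: "m \<ge> n" "i < cut m" "m' \<ge> n" "i' < cut m'" "a m i < a m' i'"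
    using spacers_vary[OF f(2)] by blast
  define d where "d = a m' i' - a m i"
  have "a m' i' \<le> K" using spacer_le mi by blast
  then have d: "d \<in> {1..K}" "a m' i' = a m i + d" using mi by (auto simp: d_def)
  have "l ^ (h n + a m' i') - l ^ (h n + a m i) = l ^ (h n + a m i) * (l ^ d - 1)"
    unfolding d(2) by (simp add: power_add algebra_simps)
  then have "norm (l ^ d - 1) = norm ((l ^ (h n + a m' i') - 1) - (l ^ (h n + a m i) - 1))"
    by (simp add: norm_mult norm_power l)
  also have "\<dots> < 2 * \<delta>"
    using norm_triangle_ineq4[of "l ^ (h n + a m' i') - 1" "l ^ (h n + a m i) - 1"]
      n[OF mi(1,2)] n[OF mi(3,4)] by linarith
  also have "\<dots> = Min D" by (simp add: \<delta>_def)
  also have "\<dots> \<le> norm (l ^ d - 1)"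
  proof (rule Min_le)
    show "finite D" "norm (l ^ d - 1) \<in> D" using d(1) unfolding D_def by blast+
  qed
  finally show False by simp
qed

lemma continuous_eigenvalueI:
  assumes ne: "X \<noteq> {}" and q: "\<forall>m\<ge>n. \<forall>i<cut m. q dvd int (h n + a m i)" "q \<ge> 1"
    and l: "l powi q = 1"
  shows "continuous_eigenvalue X shift l"
proof -
  have l0: "l \<noteq> 0" using l q(2) by auto
  define \<rho> where "\<rho> x = (SOME r. approximable {j. q dvd j + r} x)" for x
  \<comment> \<open>The predicate \<open>P\<close> lets one pigeonhole argument give both the
    existence of a residue, with \<open>P\<close> trivial, and local constancy, where
    \<open>P\<close> avoids the residue of \<open>x\<close>.\<close>
  have residue: "\<exists>c\<in>{0..<q}. \<forall>M. P M c \<and> (\<exists>m j. q dvd j + c \<and> agrees x M m j)"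
    if ex: "\<And>M. \<exists>m j. P M ((- j) mod q) \<and> agrees x M m j"
      and mono: "\<And>M M' c. P M' c \<Longrightarrow> M \<le> M' \<Longrightarrow> P M c" for x and P :: "int \<Rightarrow> int \<Rightarrow> bool"
  proof (rule pigeonhole_antimono)
    fix M
    obtain m j where "P M ((- j) mod q)" "agrees x M m j" using ex by blast
    moreover have "q dvd j + (- j) mod q" by (simp add: dvd_eq_mod_eq_0 mod_add_right_eq)
    moreover have "(- j) mod q \<in> {0..<q}" using q(2) by simp
    ultimately show "\<exists>c\<in>{0..<q}. P M c \<and> (\<exists>m j. q dvd j + c \<and> agrees x M m j)" by blast
  qed (simp, use mono agrees_antimono in blast)
  have \<rho>: "approximable {j. q dvd j + \<rho> x} x" if x: "x \<in> X" for x
  proof -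
    have "\<exists>c. approximable {j. q dvd j + c} x"
      using residue[of "\<lambda>_ _. True" x] approximable_UNIV[OF x] unfolding approximable_def by auto
    then show ?thesis unfolding \<rho>_def by (rule someI_ex)
  qed
  have \<rho>_eq: "q dvd \<rho> x - r" if "x \<in> X" "approximable {j. q dvd j + r} x" for x r
    using residue_unique[OF that(1) q(1) that(2) \<rho>[OF that(1)]] .
  have \<rho>_shift: "q dvd \<rho> (shift x) - (\<rho> x - 1)" if x: "x \<in> X" for x
  proof (rule \<rho>_eq[OF shift_in_X[OF x]])
    \<comment> \<open>The shift moves the origin one place to the right in \<open>w m\<close>:
      \<open>j\<close> becomes \<open>j + 1\<close> and the residue drops by 1.\<close>
    show "approximable {j. q dvd j + (\<rho> x - 1)} (shift x)"
      unfolding approximable_def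
    proof
      fix M :: int
      obtain m j where j: "q dvd j + \<rho> x" "agrees x (M + 1) m j"
        using \<rho>[OF x] unfolding approximable_def by blast
      have "agrees (shift x) M m (j + 1)"
        unfolding agrees_def shift_def
      proof (intro allI impI)
        fix z assume "\<bar>z\<bar> \<le> M"
        then have "\<bar>z + 1\<bar> \<le> M + 1" by linarith
        with j(2)[unfolded agrees_def] show "0 \<le> z + (j + 1) \<and> z + (j + 1) < int (h m) \<and> x (z + 1) = w m ! nat (z + (j + 1))"
          by (metis add.assoc add.commute)
      qed
      moreover have "j + 1 \<in> {j. q dvd j + (\<rho> x - 1)}" using j(1) by simp
      ultimately show "\<exists>m j. j \<in> {j. q dvd j + (\<rho> x - 1)} \<and> agrees (shift x) M m j" by blast
    qed
  qed
  have \<rho>_local: "\<exists>M. \<forall>y\<in>X. (\<forall>z. \<bar>z\<bar> \<le> M \<longrightarrow> y z = x z) \<longrightarrow> q dvd \<rho> x - \<rho> y" if x: "x \<in> X" for x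
  \<comment> \<open>Otherwise points \<open>y\<close> agreeing with \<open>x\<close> on ever larger
    windows provide approximations of \<open>x\<close> with residues different from that of
    \<open>\<rho> x\<close>; one such residue fits all windows, against uniqueness.\<close>
  proof (rule ccontr)
    assume "\<not> ?thesis"
    then have bad: "\<exists>y\<in>X. (\<forall>z. \<bar>z\<bar> \<le> M \<longrightarrow> y z = x z) \<and> \<not> q dvd \<rho> x - \<rho> y" for M by blast
    have "\<exists>m j. \<not> q dvd \<rho> x - (- j) mod q \<and> agrees x M m j" for M
    proof -
      obtain y where y: "y \<in> X" "\<forall>z. \<bar>z\<bar> \<le> M \<longrightarrow> y z = x z" "\<not> q dvd \<rho> x - \<rho> y"
        using bad by blast
      obtain m j where j: "q dvd j + \<rho> y" "agrees y M m j"
        using \<rho>[OF y(1)] unfolding approximable_def by blast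
      have "agrees x M m j" using j(2) y(2) unfolding agrees_def by auto
      moreover have "\<not> q dvd \<rho> x - (- j) mod q"
      proof
        assume "q dvd \<rho> x - (- j) mod q"
        then have "q dvd \<rho> x + j" by (metis diff_minus_eq_add mod_diff_right_eq dvd_eq_mod_eq_0)
        from dvd_diff[OF this j(1)] show False using y(3) by simp
      qed
      ultimately show ?thesis by blast
    qed
    from residue[of "\<lambda>_ c. \<not> q dvd \<rho> x - c", OF this]
    obtain c where "\<not> q dvd \<rho> x - c" "approximable {j. q dvd j + c} x"
      unfolding approximable_def by auto
    then show False using \<rho>_eq[OF x] by blast
  qed
  \<comment> \<open>The value \<open>\<rho> x\<close> is determined only modulo \<open>q\<close>;
    \<open>l powi q = 1\<close> makes \<open>f\<close> insensitive to the choice.\<close>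
  define f where "f x = l powi (- \<rho> x)" for x
  have f_eq: "l powi u = l powi v" if dvd: "q dvd u - v" for u v
  proof -
    obtain b where "u - v = q * b" using dvd by blast
    then have "u = v + q * b" by simp
    then have "l powi u = l powi v * (l powi q) powi b" using l0
      by (simp add: power_int_add power_int_mult)
    then show ?thesis using l by simp
  qed
  have "continuous_on X f"
    unfolding continuous_on_topological
  proof (intro ballI allI impI)
    fix x B assume x: "x \<in> X" and B: "open B" "f x \<in> B"
    obtain M where M: "\<And>y. y \<in> X \<Longrightarrow> \<forall>z. \<bar>z\<bar> \<le> M \<longrightarrow> y z = x z \<Longrightarrow> q dvd \<rho> x - \<rho> y"
      using \<rho>_local[OF x] by blast
    have "f y = f x" if "y \<in> X" "\<forall>z. \<bar>z\<bar> \<le> M \<longrightarrow> y z = x z" for y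
      unfolding f_def using M[OF that] by (intro f_eq) simp
    then show "\<exists>A. open A \<and> x \<in> A \<and> (\<forall>y\<in>X. y \<in> A \<longrightarrow> f y \<in> B)"
      using B(2) open_cylinder[of M x] by (intro exI[of _ "{y. \<forall>z. \<bar>z\<bar> \<le> M \<longrightarrow> y z = x z}"]) auto
  qed
  moreover have "f (shift x) = l * f x" if x: "x \<in> X" for x
  proof -
    have "q dvd - \<rho> (shift x) - (1 - \<rho> x)"
      using \<rho>_shift[OF x] by (subst dvd_minus_iff[symmetric]) (simp add: algebra_simps)
    then have "f (shift x) = l powi (1 + - \<rho> x)" unfolding f_def by (intro f_eq) simp
    also have "\<dots> = l * f x" unfolding f_def using l0 by (subst power_int_add) auto
    finally show ?thesis .
  qed
  moreover have "f x \<noteq> 0" for x using l0 by (simp add: f_def)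
  ultimately show ?thesis using ne unfolding continuous_eigenvalue_def by blast
qed

end

section \<open>Rational angles and the final assembly\<close>

lemma exp_rational_power_eq_1_iff:
  assumes "coprime p q" "q \<ge> 1"
  shows "exp (2 * of_real pi * \<i> * (of_int p / of_int q)) ^ N = (1::complex) \<longleftrightarrow> q dvd int N"
proof -
  have "exp (2 * of_real pi * \<i> * (of_int p / of_int q)) ^ N
    = exp (\<i> * of_real (2 * pi * (real N * of_int p / of_int q)) :: complex)"
    by (simp add: exp_of_nat_mult[symmetric] algebra_simps)
  also have "\<dots> = 1 \<longleftrightarrow> (\<exists>b::int. 2 * pi * (real N * of_int p / of_int q) = of_int (2 * b) * pi)"
    by (simp add: exp_eq_1)
  also have "\<dots> \<longleftrightarrow> (\<exists>b::int. real N * of_int p = of_int b * real_of_int q)"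
    using assms(2) by (auto simp: field_simps)
  also have "\<dots> \<longleftrightarrow> (\<exists>b::int. int N * p = b * q)"
    by (metis of_int_eq_iff of_int_mult of_int_of_nat_eq)
  also have "\<dots> \<longleftrightarrow> q dvd int N * p" by (auto simp: dvd_def mult.commute)
  also have "\<dots> \<longleftrightarrow> q dvd int N"
    using assms(1) by (simp add: coprime_dvd_mult_left_iff coprime_commute)
  finally show ?thesis .
qed

theorem proposition4p14:
  fixes cut :: "nat \<Rightarrow> nat" and a :: "nat \<Rightarrow> nat \<Rightarrow> nat"
  assumes "standard cut"
    and "bounded_spacers cut a"
    and "aperiodic_subshift (ferenczi_subshift cut a)"
  shows "(\<nexists>l. continuous_irrational_eigenvalue (ferenczi_subshift cut a) shift l) \<and>
    (\<forall>p q :: int. coprime p q \<and> q \<ge> 1 \<longrightarrow>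
      (continuous_eigenvalue (ferenczi_subshift cut a) shift
          (exp (2 * of_real pi * \<i> * (of_int p / of_int q))) \<longleftrightarrow>
       (\<exists>n. \<forall>m\<ge>n. \<forall>i<cut m. q dvd int (length (generating_word cut a n) + a m i))))"
proof -
  obtain K where K: "\<And>n i. i < cut n \<Longrightarrow> a n i \<le> K"
    using assms(2) unfolding bounded_spacers_def by blast
  interpret aperiodic_ferenczi cut a K
    using assms(1,3) K by unfold_locales (auto simp: standard_def aperiodic_subshift_def)
  have ne: "X \<noteq> {}" using assms(3) by (simp add: aperiodic_subshift_def)
  have "\<not> continuous_irrational_eigenvalue X shift l" for l
  proof
    assume "continuous_irrational_eigenvalue X shift l"
    then obtain \<alpha> :: real where ev: "continuous_eigenvalue X shift l" and \<alpha>: "\<alpha> \<notin> \<rat>"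
      and l: "l = exp (2 * of_real pi * \<i> * of_real \<alpha>)"
      unfolding continuous_irrational_eigenvalue_def by blast
    obtain d where d: "d > 0" "l ^ d = 1"
      using eigenvalue_root_of_unity[OF ev] by (auto simp: l)
    have "l ^ d = exp (\<i> * of_real (2 * pi * (real d * \<alpha>)))"
      unfolding l by (simp add: exp_of_nat_mult[symmetric] algebra_simps)
    with d obtain b :: int where "2 * pi * (real d * \<alpha>) = of_int (2 * b) * pi"
      by (auto simp: exp_eq_1)
    then have "\<alpha> = of_int b / of_nat d" using d(1) by (simp add: field_simps)
    then show False using \<alpha> by simp
  qed
  moreover have "continuous_eigenvalue X shift (exp (2 * of_real pi * \<i> * (of_int p / of_int q)))
    \<longleftrightarrow> (\<exists>n. \<forall>m\<ge>n. \<forall>i<cut m. q dvd int (h n + a m i))" (is "?L \<longleftrightarrow> ?R")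
    if pq: "coprime p q" "q \<ge> 1" for p q :: int
  proof -
    define l :: complex where "l = exp (2 * of_real pi * \<i> * (of_int p / of_int q))"
    have pow: "l ^ N = 1 \<longleftrightarrow> q dvd int N" for N
      unfolding l_def by (rule exp_rational_power_eq_1_iff[OF pq])
    have q: "l ^ nat q = 1" unfolding pow using pq(2) by simp
    have "norm l = 1"
    proof -
      have "norm l ^ nat q = 1" using q by (metis norm_one norm_power)
      then show ?thesis using pq(2) power_eq_imp_eq_base[of "norm l" "nat q" 1] by simp
    qed
    show ?thesis
    proof
      assume ?L
      then obtain f x where f: "continuous_on X f" "x \<in> X" "f x \<noteq> 0" "\<forall>x\<in>X. f (shift x) = l * f x"
        unfolding continuous_eigenvalue_def l_def by blast
      \<comment> \<open>Since \<open>l ^ nat q = 1\<close>, there are finitely many powers of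
        \<open>l\<close>; \<delta> separates 1 from the others, so a power within distance less than
        \<delta> of 1 equals 1.\<close>
      define D where "D = (\<lambda>r. norm (l ^ r - 1)) ` {r. r < nat q \<and> l ^ r \<noteq> 1}"
      define \<delta> where "\<delta> = Min (insert 1 D)"
      have D: "finite D" "\<forall>e\<in>D. e > 0" by (auto simp: D_def)
      then have "\<delta> > 0" unfolding \<delta>_def by (auto simp: Min_gr_iff)
      then obtain n where n: "\<And>m i. m \<ge> n \<Longrightarrow> i < cut m \<Longrightarrow> norm (l ^ (h n + a m i) - 1) < \<delta>"
        using eigenvalue_power_near_1[OF f \<open>norm l = 1\<close>] by blast
      have "q dvd int N" if N: "norm (l ^ N - 1) < \<delta>" for N
      proof (rule ccontr)
        assume "\<not> q dvd int N"
        then have "l ^ N \<noteq> 1" by (simp add: pow)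
        have "l ^ N = l ^ (nat q * (N div nat q) + N mod nat q)" by simp
        also have "\<dots> = l ^ (N mod nat q)" by (simp only: power_add power_mult q power_one mult_1)
        finally have eq: "l ^ N = l ^ (N mod nat q)" .
        then have "norm (l ^ N - 1) \<in> D" unfolding D_def
          using \<open>l ^ N \<noteq> 1\<close> pq(2) by (intro image_eqI[of _ _ "N mod nat q"]) auto
        then have "\<delta> \<le> norm (l ^ N - 1)" unfolding \<delta>_def using D(1) by (intro Min_le) auto
        then show False using N by simp
      qed
      then show ?R using n by blast
    next
      assume ?R
      moreover have "l powi q = 1" using q pq(2) by (simp add: power_int_def)
      ultimately have "continuous_eigenvalue X shift l"
        using continuous_eigenvalueI[OF ne _ pq(2)] by blast
      then show ?L by (simp add: l_def)
    qed
  qed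
  ultimately show ?thesis by blast
qed

end
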